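(* Let $\mathcal{C}\subseteq\mathbb{R}^n$ be a compact convex set with vertex set $\mathcal{V}$ and let $\mathbf{x}^{(0)}\in\mathcal{V}$. Given a specific Carathéodory-amenable algorithm (CAA), let $(\alpha^{(T)},\mathcal{S}^{(T)},\mathbf{x}^{(T)})=\mathrm{PM}(\mathbf{x}^{(0)})$ denote the output of its modification with the pivoting meta algorithm (PM). Suppose that there exists an iteration $R\in\{0,1,\dots,T\}$ such that $\mathcal{S}^{(t)}\subseteq\mathcal{C}^*$ for all $t\in\{R,R+1,\dots,T\}$, where $\emptyset\ne\mathcal{C}^*\subseteq\mathcal{C}$. Then $|\mathcal{S}^{(t)}|\le\dim(\mathcal{C}^* )+1$ for all $t\in\{R,R+1,\dots,T\}$.
   Context: $\dim$ of a set is the dimension of its affine hull. Vertices of $\mathcal{C}$ are its extreme points. $\Delta_{|\mathcal{V}|}$ is the set of finitely supported weight vectors $(\alpha_{\mathbf{s}})_{\mathbf{s}\in\mathcal{V}}$ with nonnegative entries summing to $1$. $[m]=\{1,\dots,m\}$. For $\mathbf{x}\in\mathbb{R}^n$, $\tilde{\mathbf{x}}=(\mathbf{x}^\intercal,0,1)^\intercal\in\mathbb{R}^{n+2}$. $M_{:,i}$ is the $i$th column of $M$. $D_n\in\mathbb{R}^{(n+2)\times(n+1)}$ is the matrix whose first $n$ rows are $(I_n,\mathbf{0})$ and whose last two rows have all entries $1$. A convex-combination update (CCU) is a procedure taking $(\alpha,\mathcal{S},\mathbf{x})$ with $\alpha\in\Delta_{|\mathcal{V}|}$, $\mathcal{S}=\{\mathbf{s}:\alpha_{\mathbf{s}}>0\}$,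 $\mathbf{x}=\sum_{\mathbf{s}\in\mathcal{S}}\alpha_{\mathbf{s}}\mathbf{s}\in\mathcal{C}$, and returning $(\beta,\mathcal{T},\mathbf{y})$ with $\beta\in\Delta_{|\mathcal{V}|}$, $\mathcal{T}=\{\mathbf{s}:\beta_{\mathbf{s}}>0\}$, $\mathbf{y}=\sum_{\mathbf{s}\in\mathcal{T}}\beta_{\mathbf{s}}\mathbf{s}\in\mathcal{C}$, such that either $\mathcal{T}\subseteq\mathcal{S}$ or there is exactly one $\mathbf{v}\in\mathcal{T}\setminus\mathcal{S}$ with $\mathcal{T}\subseteq\mathcal{S}\cup\{\mathbf{v}\}$. A Carathéodory-amenable algorithm (CAA) starts at $\mathbf{x}^{(0)}\in\mathcal{V}$ with $\alpha^{(0)}$ concentrated at $\mathbf{x}^{(0)}$ and $\mathcal{S}^{(0)}=\{\mathbf{x}^{(0)}\}$, and for $t=0,\dots,T-1$ sets $(\alpha^{(t+1)},\mathcal{S}^{(t+1)},\mathbf{x}^{(t+1)})=\mathrm{CCU}(\alpha^{(t)},\mathcal{S}^{(t)},\mathbf{x}^{(t)})$. PM applied to a CAA: set $M^{(0)}=(\tilde{\mathbf{x}}^{(0)},D_n)\in\mathbb{R}^{(n+2)\times(n+2)}$, $\alpha^{(0)}$ concentrated at $\mathbf{x}^{(0)}$, $\mathcal{S}^{(0)}=\{\mathbf{x}^{(0)}\}$. For $t=0,\dots,T-1$: $(\beta^{(t+1)},\mathcal{T}^{(t+1)},\mathbf{x}^{(t+1)})=\mathrm{CCU}(\alpha^{(t)},\mathcal{S}^{(t)},\mathbf{x}^{(t)})$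 with the CCU of the CAA, then $(M^{(t+1)},\alpha^{(t+1)},\mathcal{S}^{(t+1)})=\mathrm{ASC}(M^{(t)},\beta^{(t+1)},\mathcal{T}^{(t+1)},\mathcal{T}^{(t+1)}\setminus\mathcal{S}^{(t)})$. Active set cleanup algorithm $\mathrm{ASC}(N,\beta,\mathcal{T},\mathcal{D})$, where $|\mathcal{D}|\le1$: (i) If $\mathcal{D}=\emptyset$: for $i\in[n+2]$ set $\lambda_i=\beta_{\mathbf{s}}$ if $N_{:,i}=\tilde{\mathbf{s}}$ for some $\mathbf{s}\in\mathcal{T}$, and $\lambda_i=0$ otherwise; set $Q=N$. (ii) If $\mathcal{D}=\{\mathbf{v}\}$: let $A=(N,\tilde{\mathbf{v}})\in\mathbb{R}^{(n+2)\times(n+3)}$; for $i\in[n+3]$ set $\mu_i=\beta_{\mathbf{s}}$ if $A_{:,i}=\tilde{\mathbf{s}}$ for some $\mathbf{s}\in\mathcal{T}$, and $\mu_i=0$ otherwise; let $\mathbf{r}=-N^{-1}\tilde{\mathbf{v}}$, choose $k\in\arg\min_{i\in[n+2],\,r_i<0}(-\mu_i/r_i)$ and put $\theta^*=-\mu_k/r_k\ge0$; set $\lambda_k=\mu_{n+3}+\theta^*$ and $\lambda_i=\mu_i+\theta^*r_i$ for $i\in[n+2]$, $i\ne k$; let $Q$ be $N$ with its $k$th column replaced by $\tilde{\mathbf{v}}$. (iii) In both cases choose $\ell\in\{i\in[n+2]:Q_{n+1,i}\ne0\}$; for $i\in[n+2]$ set $M_{:,i}=Q_{:,i}+Q_{:,\ell}$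 if $\lambda_i=0$ and $Q_{n+1,i}=0$, and $M_{:,i}=Q_{:,i}$ otherwise; for $\mathbf{s}\in\mathcal{V}$ set $\alpha_{\mathbf{s}}=\lambda_i$ if there is $i\in[n+2]$ with $\tilde{\mathbf{s}}=M_{:,i}$, and $\alpha_{\mathbf{s}}=0$ otherwise; set $\mathcal{S}=\{\mathbf{s}\in\mathcal{V}:\alpha_{\mathbf{s}}>0\}$. Return $(M,\alpha,\mathcal{S})$. *)

theory Defs
  imports "HOL-Analysis.Analysis"
begin

definition vertices :: "(real ^ 'n) set \<Rightarrow> (real ^ 'n) set" where
  "vertices C = {x. x extreme_point_of C}"

text \<open>A weight vector indexed by a set \<open>V\<close> is a function on the whole space that vanishes
  outside \<open>V\<close>.\<close>

definition weights :: "'a set \<Rightarrow> ('a \<Rightarrow> real) set" where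
  "weights V = {\<alpha>. finite {s. \<alpha> s \<noteq> 0} \<and> {s. \<alpha> s \<noteq> 0} \<subseteq> V \<and> (\<forall>s. 0 \<le> \<alpha> s)
                  \<and> (\<Sum>s | \<alpha> s \<noteq> 0. \<alpha> s) = 1}"

definition unit_weight :: "'a \<Rightarrow> 'a \<Rightarrow> real" where
  "unit_weight x = (\<lambda>s. if s = x then 1 else 0)"


section \<open>Convex-combination updates\<close>

type_synonym 'n state = "(real ^ 'n \<Rightarrow> real) \<times> (real ^ 'n) set \<times> (real ^ 'n)"

definition valid_state :: "(real ^ 'n) set \<Rightarrow> 'n state \<Rightarrow> bool" where
  "valid_state C = (\<lambda>(\<alpha>, S, x).
     \<alpha> \<in> weights (vertices C) \<and> S = {s \<in> vertices C. \<alpha> s > 0}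
     \<and> x = (\<Sum>s\<in>S. \<alpha> s *\<^sub>R s) \<and> x \<in> C)"

text \<open>The procedure is an input-output relation, total on the valid inputs. It need not be
  single-valued: its answer may also depend on the iteration or on arbitrary choices.\<close>

definition is_CCU :: "(real ^ 'n) set \<Rightarrow> ('n state \<Rightarrow> 'n state \<Rightarrow> bool) \<Rightarrow> bool" where
  "is_CCU C ccu \<longleftrightarrow>
     (\<forall>\<alpha> S x. valid_state C (\<alpha>, S, x) \<longrightarrow>
        (\<exists>out. ccu (\<alpha>, S, x) out) \<and>
        (\<forall>\<beta> T y. ccu (\<alpha>, S, x) (\<beta>, T, y) \<longrightarrow>
           valid_state C (\<beta>, T, y) \<and>
           (T \<subseteq> S \<or> (\<exists>!v. v \<in> T - S \<and> T \<subseteq> S \<union> {v}))))"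


section \<open>Matrices with \<open>n + 2\<close> rows\<close>

text \<open>Adding an index is rendered by \<open>option\<close>. For \<open>n = CARD('n)\<close>, the row index
  \<open>Some (Some i)\<close> is one of the first \<open>n\<close> rows, \<open>Some None\<close> is row \<open>n + 1\<close> and
  \<open>None\<close> is row \<open>n + 2\<close>. Columns of square matrices are labelled by the same type, but their
  order plays no role: a column adjoined to a matrix, on either side, gets the label \<open>None\<close>.\<close>

type_synonym 'n idx = "'n option option"

abbreviation row_n1 :: "'n idx" where
  "row_n1 \<equiv> Some None"

definition tilde :: "real ^ 'n \<Rightarrow> real ^ ('n::finite) idx" where
  "tilde x = (\<chi> i. case i of Some (Some j) \<Rightarrow> x $ j | Some None \<Rightarrow> 0 | None \<Rightarrow> 1)"

definition D_mat :: "real ^ ('n option) ^ (('n::finite) idx)" where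
  "D_mat = (\<chi> i j. case i of Some (Some i') \<Rightarrow> (if j = Some i' then 1 else 0) | _ \<Rightarrow> 1)"

definition adjoin_col :: "real ^ 'r \<Rightarrow> real ^ 'c ^ 'r \<Rightarrow> real ^ (('c::finite) option) ^ 'r" where
  "adjoin_col v A = (\<chi> i j. case j of Some c \<Rightarrow> A $ i $ c | None \<Rightarrow> v $ i)"

definition replace_col :: "'c \<Rightarrow> real ^ 'r \<Rightarrow> real ^ 'c ^ 'r \<Rightarrow> real ^ ('c::finite) ^ 'r" where
  "replace_col k v A = (\<chi> i j. if j = k then v $ i else A $ i $ j)"


section \<open>Active set cleanup\<close>

text \<open>The point \<open>s\<close> chosen below is unique because \<open>tilde\<close> is injective.\<close>

definition col_weights ::
    "(real ^ 'n \<Rightarrow> real) \<Rightarrow> (real ^ 'n) set \<Rightarrow> real ^ 'c ^ (('n::finite) idx) \<Rightarrow> real ^ 'c" where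
  "col_weights \<beta> T A =
     (\<chi> i. if \<exists>s\<in>T. column i A = tilde s then \<beta> (SOME s. s \<in> T \<and> column i A = tilde s) else 0)"

definition pivot ::
    "real ^ (('n::finite) idx) ^ ('n idx) \<Rightarrow> (real ^ 'n \<Rightarrow> real) \<Rightarrow> (real ^ 'n) set \<Rightarrow> real ^ 'n
     \<Rightarrow> real ^ ('n idx) ^ ('n idx) \<Rightarrow> real ^ ('n idx) \<Rightarrow> bool" where
  "pivot N \<beta> T v Q l \<longleftrightarrow>
     (let \<mu> = col_weights \<beta> T (adjoin_col (tilde v) N);
          r = - (matrix_inv N *v tilde v)
      in \<exists>k. is_arg_min (\<lambda>i. - \<mu> $ (Some i) / r $ i) (\<lambda>i. r $ i < 0) k \<and>
             (let \<theta> = - \<mu> $ (Some k) / r $ k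
              in l = (\<chi> i. if i = k then \<mu> $ None + \<theta> else \<mu> $ (Some i) + \<theta> * r $ i)) \<and>
             Q = replace_col k (tilde v) N)"

text \<open>Step (iii). In a run of the algorithm \<open>M\<close> is invertible, so the column chosen in the
  definition of \<open>\<alpha>\<close> is unique.\<close>

definition cleanup ::
    "(real ^ 'n) set \<Rightarrow> real ^ (('n::finite) idx) ^ ('n idx) \<Rightarrow> real ^ ('n idx)
     \<Rightarrow> real ^ ('n idx) ^ ('n idx) \<Rightarrow> (real ^ 'n \<Rightarrow> real) \<Rightarrow> (real ^ 'n) set \<Rightarrow> bool" where
  "cleanup C Q l M \<alpha> S \<longleftrightarrow>
     (\<exists>e. Q $ row_n1 $ e \<noteq> 0 \<and>
          M = (\<chi> i j. if l $ j = 0 \<and> Q $ row_n1 $ j = 0 then Q $ i $ j + Q $ i $ e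
                      else Q $ i $ j)) \<and>
     \<alpha> = (\<lambda>s. if s \<in> vertices C \<and> (\<exists>i. tilde s = column i M)
              then l $ (SOME i. tilde s = column i M) else 0) \<and>
     S = {s \<in> vertices C. \<alpha> s > 0}"

text \<open>\<open>ASC C N \<beta> T D M \<alpha> S\<close>: on input \<open>(N, \<beta>, T, D)\<close>, some admissible choices of \<open>k\<close> and of the
  column added in step (iii) lead to the output \<open>(M, \<alpha>, S)\<close>.\<close>

definition ASC ::
    "(real ^ 'n) set \<Rightarrow> real ^ (('n::finite) idx) ^ ('n idx) \<Rightarrow> (real ^ 'n \<Rightarrow> real)
     \<Rightarrow> (real ^ 'n) set \<Rightarrow> (real ^ 'n) set
     \<Rightarrow> real ^ ('n idx) ^ ('n idx) \<Rightarrow> (real ^ 'n \<Rightarrow> real) \<Rightarrow> (real ^ 'n) set \<Rightarrow> bool" where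
  "ASC C N \<beta> T D M \<alpha> S \<longleftrightarrow>
     (\<exists>Q l. ((D = {} \<and> Q = N \<and> l = col_weights \<beta> T N) \<or> (\<exists>v. D = {v} \<and> pivot N \<beta> T v Q l))
            \<and> cleanup C Q l M \<alpha> S)"


section \<open>The pivoting meta algorithm\<close>

text \<open>A Caratheodory-amenable algorithm enters only through its update \<open>ccu\<close>, its starting
  vertex and its number \<open>T\<close> of iterations. The sequences are constrained up to index \<open>T\<close>.\<close>

definition PM_run ::
    "(real ^ 'n) set \<Rightarrow> ('n state \<Rightarrow> 'n state \<Rightarrow> bool) \<Rightarrow> real ^ 'n \<Rightarrow> nat
     \<Rightarrow> (nat \<Rightarrow> real ^ (('n::finite) idx) ^ ('n idx)) \<Rightarrow> (nat \<Rightarrow> real ^ 'n \<Rightarrow> real)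
     \<Rightarrow> (nat \<Rightarrow> (real ^ 'n) set) \<Rightarrow> (nat \<Rightarrow> real ^ 'n) \<Rightarrow> bool" where
  "PM_run C ccu x0 T M \<alpha> S x \<longleftrightarrow>
     M 0 = adjoin_col (tilde x0) D_mat \<and> \<alpha> 0 = unit_weight x0 \<and> S 0 = {x0} \<and> x 0 = x0 \<and>
     (\<forall>t<T. \<exists>\<beta> U. ccu (\<alpha> t, S t, x t) (\<beta>, U, x (Suc t)) \<and>
                  ASC C (M t) \<beta> U (U - S t) (M (Suc t)) (\<alpha> (Suc t)) (S (Suc t)))"

end

theory Submission imports Defs begin

text \<open>The cleanup keeps \<open>M\<close> invertible: inserting \<open>tilde v\<close> in place of a column \<open>k\<close> with
  \<open>r $ k < 0\<close> multiplies the determinant by \<open>- r $ k\<close>, and step (iii) only adds a column to other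
  columns. Since every active vertex occurs, lifted by \<open>tilde\<close>, as a column of \<open>M\<close>, the active
  set is affinely independent.\<close>

lemma inj_tilde: "inj tilde"
proof (rule injI)
  fix x y :: "real ^ 'n" assume "tilde x = tilde y"
  then have "tilde x $ Some (Some i) = tilde y $ Some (Some i)" for i
    by simp
  then show "x = y"
    by (simp add: tilde_def vec_eq_iff)
qed

lemma invertible_iff_ker_trivial:
  fixes A :: "real ^ 'm ^ 'm"
  shows "invertible A \<longleftrightarrow> (\<forall>c. A *v c = 0 \<longrightarrow> c = 0)"
  by (simp add: invertible_left_inverse matrix_left_invertible_ker)

text \<open>The last entry of every \<open>tilde s\<close> is 1, so an affine dependence, whose
  coefficients sum to 0, lifts to a linear dependence among columns of \<open>A\<close>.\<close>

lemma affine_independent_if_tilde_columns: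
  fixes S :: "(real ^ 'n) set" and A :: "real ^ 'n idx ^ 'n idx"
  assumes "invertible A" and cols: "tilde ` S \<subseteq> columns A"
  shows "finite S" and "\<not> affine_dependent S"
proof -
  show fin: "finite S"
    using finite_subset[OF cols] inj_on_subset[OF inj_tilde]
    by (auto simp: columns_def full_SetCompr_eq intro: finite_imageD)
  have ind: "independent (tilde ` S)"
    using independent_mono[OF _ cols] \<open>invertible A\<close>
      det_dependent_columns[of A, unfolded dependent_vec_eq]
    by (auto simp: invertible_det_nz)
  show "\<not> affine_dependent S"
  proof
    assume "affine_dependent S"
    then obtain u w where u: "sum u S = 0" "w \<in> S" "u w \<noteq> 0" "(\<Sum>s\<in>S. u s *\<^sub>R s) = 0"
      using fin by (auto simp: affine_dependent_explicit_finite)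
    have "(\<Sum>s\<in>S. u s *\<^sub>R tilde s) $ i = 0" for i
    proof -
      have "(\<Sum>s\<in>S. u s * s $ j) = 0" for j
        using arg_cong[OF u(4), of "\<lambda>z. z $ j"] by simp
      then show ?thesis
        \<comment> \<open>Row \<open>None\<close> is \<open>sum u S = 0\<close>,
          \<open>row_n1\<close> is zero, and the other rows are the coordinates of
          \<open>u(4)\<close>.\<close>
        using u(1) by (cases i; cases "the i") (simp_all add: tilde_def)
    qed
    then have "(\<Sum>s\<in>S. u s *\<^sub>R tilde s) = 0"
      by (simp add: vec_eq_iff)
    then have "(\<Sum>y\<in>tilde ` S. u (inv tilde y) *\<^sub>R y) = 0"
      by (simp add: sum.reindex inj_tilde inj_on_subset[OF inj_tilde])
    then have "dependent (tilde ` S)"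
      using fin u(2,3) by (auto simp: dependent_finite inj_tilde intro!: exI[of _ "\<lambda>y. u (inv tilde y)"])
    with ind show False
      by simp
  qed
qed

lemma sum_UNIV_option:
  "(\<Sum>i\<in>(UNIV :: 'a::finite option set). f i) = f None + (\<Sum>i\<in>UNIV. f (Some i))"
  by (simp add: UNIV_option_conv sum.reindex)

text \<open>Rows \<open>Some None\<close> and \<open>None\<close> differ only in the entry of
  \<open>tilde x\<close>, which forces \<open>c $ None = 0\<close>; the identity block of
  \<open>D_mat\<close> and the zero sum of the \<open>c $ Some j\<close> then clear the
  rest.\<close>

lemma invertible_initial: "invertible (adjoin_col (tilde x) D_mat)"
  unfolding invertible_iff_ker_trivial
proof (intro allI impI)
  fix c assume *: "adjoin_col (tilde x) D_mat *v c = 0"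
  have eq: "c $ None * tilde x $ i + (\<Sum>j\<in>UNIV. c $ Some j * D_mat $ i $ j) = 0" for i
    using arg_cong[OF *, of "\<lambda>z. z $ i"]
    by (simp add: matrix_vector_mult_def adjoin_col_def sum_UNIV_option mult.commute)
  have sum0: "(\<Sum>j\<in>UNIV. c $ Some j) = 0"
    using eq[of "Some None"] by (simp add: tilde_def D_mat_def)
  have None0: "c $ None = 0"
    using eq[of None] sum0 by (simp add: tilde_def D_mat_def)
  have SomeSome0: "c $ Some (Some j) = 0" for j
    using eq[of "Some (Some j)"] None0
    by (simp add: D_mat_def if_distrib[of "\<lambda>z. _ * z"] sum.delta cong: if_cong)
  have "c $ Some None = 0"
    using sum0 SomeSome0 by (simp add: sum_UNIV_option)
  with None0 SomeSome0 show "c = 0"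
    by (metis option.exhaust vec_eq_iff zero_index)
qed

text \<open>Cramer's rule: the replacement multiplies the determinant by the coordinate of
  \<open>v\<close> at \<open>k\<close> in the basis of columns of \<open>A\<close>.\<close>

lemma invertible_replace_col:
  fixes A :: "real ^ 'm ^ 'm"
  assumes "invertible A" and "(matrix_inv A *v v) $ k \<noteq> 0"
  shows "invertible (replace_col k v A)"
proof -
  have "A ** matrix_inv A = mat 1"
    using someI_ex[OF assms(1)[unfolded invertible_def]] by (simp add: matrix_inv_def)
  then have v: "A *v (matrix_inv A *v v) = v"
    by (simp add: matrix_vector_mul_assoc)
  have "det (replace_col k v A) = (matrix_inv A *v v) $ k * det A"
    using cramer_lemma[of k A "matrix_inv A *v v"] by (simp only: v replace_col_def)
  with assms show ?thesis
    by (simp add: invertible_det_nz)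
qed

text \<open>Collecting the added multiples of column \<open>e\<close> turns \<open>?B *v c\<close>
  into \<open>A\<close> applied to \<open>c\<close> shifted by \<open>\<sigma>\<close> in coordinate
  \<open>e\<close> alone.\<close>

lemma invertible_add_col:
  fixes A :: "real ^ 'm ^ 'm"
  assumes "invertible A" and "\<not> P e"
  shows "invertible (\<chi> i j. if P j then A $ i $ j + A $ i $ e else A $ i $ j)" (is "invertible ?B")
  unfolding invertible_iff_ker_trivial
proof (intro allI impI)
  fix c assume *: "?B *v c = 0"
  define \<sigma> where "\<sigma> = (\<Sum>j | P j. c $ j)"
  have "A *v (c + \<sigma> *\<^sub>R axis e 1) = ?B *v c"
  proof -
    have "(?B *v c) $ i = (A *v c) $ i + \<sigma> * A $ i $ e" for i
    proof -
      have "(?B *v c) $ i = (\<Sum>j\<in>UNIV. A $ i $ j * c $ j + (if P j then A $ i $ e * c $ j else 0))"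
        by (auto simp: matrix_vector_mult_def algebra_simps intro!: sum.cong)
      also have "\<dots> = (A *v c) $ i + \<sigma> * A $ i $ e"
        by (simp add: sum.distrib matrix_vector_mult_def \<sigma>_def sum.If_cases flip: sum_distrib_left)
      finally show ?thesis .
    qed
    then show ?thesis
      by (simp add: vec_eq_iff matrix_vector_right_distrib matrix_vector_mult_scaleR
          matrix_vector_mult_basis column_def)
  qed
  with * assms(1) have eq: "c + \<sigma> *\<^sub>R axis e 1 = 0"
    by (simp add: invertible_iff_ker_trivial)
  have off: "c $ j = 0" if "j \<noteq> e" for j
    using arg_cong[OF eq, of "\<lambda>z. z $ j"] that by (simp add: axis_def)
  \<comment> \<open>Since \<open>P\<close> fails at \<open>e\<close>, \<open>\<sigma>\<close> sums
    only coordinates of \<open>c\<close> already known to vanish.\<close>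
  then have "\<sigma> = 0"
    using assms(2) unfolding \<sigma>_def by (intro sum.neutral) (metis mem_Collect_eq)
  with eq show "c = 0"
    by simp
qed

lemma invertible_pivot:
  assumes "invertible N" and "pivot N \<beta> T v Q l"
  shows "invertible Q"
proof -
  obtain k where k: "(- (matrix_inv N *v tilde v)) $ k < 0" and Q: "Q = replace_col k (tilde v) N"
    using assms(2) by (auto simp: pivot_def Let_def is_arg_min_def)
  from k show ?thesis
    unfolding Q by (intro invertible_replace_col assms(1)) simp
qed

text \<open>The added column has a nonzero entry in \<open>row_n1\<close>, so it is not itself
  modified.\<close>

lemma invertible_cleanup:
  assumes "invertible Q" and "cleanup C Q l M \<alpha> S"
  shows "invertible M"
  using assms invertible_add_col[of Q "\<lambda>j. l $ j = 0 \<and> Q $ row_n1 $ j = 0"]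
  by (auto simp: cleanup_def)

text \<open>A vertex whose lift is not a column of \<open>M\<close> gets weight 0 and cannot be
  active.\<close>

lemma cleanup_tilde_columns:
  assumes "cleanup C Q l M \<alpha> S"
  shows "tilde ` S \<subseteq> columns M"
  using assms by (force simp: cleanup_def columns_def split: if_splits)

text \<open>Invertibility is inherited from \<open>N\<close>; the column property is established
  afresh by the cleanup.\<close>

lemma ASC_invariant:
  assumes "invertible N" and "ASC C N \<beta> T D M \<alpha> S"
  shows "invertible M \<and> tilde ` S \<subseteq> columns M"
  using assms unfolding ASC_def
  by (metis cleanup_tilde_columns invertible_cleanup invertible_pivot)

lemma PM_run_invariant:
  assumes "PM_run C ccu x0 T M \<alpha> S x" and "t \<le> T"
  shows "invertible (M t) \<and> tilde ` S t \<subseteq> columns (M t)"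
  using assms(2)
proof (induction t)
  case 0
  have "column None (adjoin_col (tilde x0) D_mat) = tilde x0"
    by (simp add: column_def adjoin_col_def vec_eq_iff)
  then show ?case
    using assms(1) invertible_initial[of x0] by (simp add: PM_run_def columns_def) metis
next
  case (Suc t)
  then obtain \<beta> U where "ASC C (M t) \<beta> U (U - S t) (M (Suc t)) (\<alpha> (Suc t)) (S (Suc t))"
    using assms(1) unfolding PM_run_def by (meson Suc_le_eq)
  with Suc show ?case
    using ASC_invariant by (meson Suc_leD)
qed

theorem theorem5p1:
  fixes C Cstar :: "(real ^ 'n) set"
    and ccu :: "'n state \<Rightarrow> 'n state \<Rightarrow> bool"
    and x0 :: "real ^ 'n"
    and M :: "nat \<Rightarrow> real ^ ('n idx) ^ ('n idx)"
    and \<alpha> :: "nat \<Rightarrow> real ^ 'n \<Rightarrow> real"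
    and S :: "nat \<Rightarrow> (real ^ 'n) set"
    and x :: "nat \<Rightarrow> real ^ 'n"
    and R T :: nat
  assumes "compact C" and "convex C"
    and "x0 \<in> vertices C"
    and "is_CCU C ccu"
    and "PM_run C ccu x0 T M \<alpha> S x"
    and "R \<le> T"
    and "Cstar \<noteq> {}" and "Cstar \<subseteq> C"
    and "\<forall>t\<in>{R..T}. S t \<subseteq> Cstar"
  shows "\<forall>t\<in>{R..T}. finite (S t) \<and> int (card (S t)) \<le> aff_dim Cstar + 1"
proof
  fix t assume t: "t \<in> {R..T}"
  with assms(5) have "invertible (M t)" "tilde ` S t \<subseteq> columns (M t)"
    using PM_run_invariant by (metis atLeastAtMost_iff)+
  note S = affine_independent_if_tilde_columns[OF this]
  have "int (card (S t)) = aff_dim (S t) + 1"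
    using aff_dim_affine_independent[OF S(2)] by simp
  also have "\<dots> \<le> aff_dim Cstar + 1"
    using assms(9) t by (simp add: aff_dim_subset)
  \<comment> \<open>Finiteness is information of its own, as \<open>card\<close> is 0 on infinite
    sets.\<close>
  finally show "finite (S t) \<and> int (card (S t)) \<le> aff_dim Cstar + 1"
    using S(1) by simp
qed

end
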